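(* Let $J$ be one-homogeneous and let $u_\lambda$ be a singular vector of $J$ with corresponding singular value $\lambda$. Let $\alpha>0$, and let the data be $f=\gamma Ku_\lambda$ for a positive constant $\gamma$. If $\gamma>\alpha\lambda$, then $\hat u=c\,u_\lambda$ with $$c=\gamma-\alpha\lambda$$ is a minimizer of $u\mapsto\frac12\|Ku-f\|_{\mathcal H}^2+\alpha J(u)$ over $u\in\mathrm{dom}(J)$.
   Context: Setting: $\mathcal U$ is a real Banach space that is the dual of some Banach space, $\mathcal H$ is a real Hilbert space, $K:\mathcal U\to\mathcal H$ is a bounded linear operator, and $J:\mathcal U\to\mathbb{R}\cup\{+\infty\}$ is proper, convex and non-negative, with $\mathrm{dom}(J)=\{u: J(u)<\infty\}$ and with non-empty subdifferential at every $u\in\mathrm{dom}(J)$. One-homogeneous means $J(cu)=|c|J(u)$ for all $c\in\mathbb{R}$, $u\in\mathcal U$ (with $0\cdot\infty=0$). $K^*:\mathcal H\to\mathcal U^*$ is the adjoint, $\langle K^*h,u\rangle_{\mathcal U}=\langle h,Ku\rangle_{\mathcal H}$. The subdifferential is $\partial J(u)=\{p\in\mathcal U^* : J(v)-J(u)-\langle p,v-u\rangle_{\mathcal U}\ge 0\ \forall v\in\mathcal U\}$. A singular vector of $J$ with singular value $\lambda$ is an element $u_\lambda\ne0$ with $\|Ku_\lambda\|_{\mathcal H}=1$ and $\lambda K^*Ku_\lambda\in\partial J(u_\lambda)$. *)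

theory Defs
  imports "HOL-Analysis.Analysis"
begin

(* Extended-valued functionals have values in ereal, where 0 * \<infinity> = 0. *)

definition eff_dom :: "('a \<Rightarrow> ereal) \<Rightarrow> 'a set" where
  "eff_dom J = {u. J u < \<infinity>}"

definition proper_functional :: "('a \<Rightarrow> ereal) \<Rightarrow> bool" where
  "proper_functional J \<longleftrightarrow> (\<forall>u. J u \<noteq> -\<infinity>) \<and> eff_dom J \<noteq> {}"

definition convex_functional :: "('a::real_vector \<Rightarrow> ereal) \<Rightarrow> bool" where
  "convex_functional J \<longleftrightarrow>
     (\<forall>u v. \<forall>t\<in>{0..1::real}.
        J ((1 - t) *\<^sub>R u + t *\<^sub>R v) \<le> ereal (1 - t) * J u + ereal t * J v)"

definition one_homogeneous :: "('a::real_vector \<Rightarrow> ereal) \<Rightarrow> bool" where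
  "one_homogeneous J \<longleftrightarrow> (\<forall>(c::real) u. J (c *\<^sub>R u) = ereal \<bar>c\<bar> * J u)"

(* For proper J the set below is empty at every u outside eff_dom J: testing
   with v in eff_dom J gives J v - J u = -\<infinity>. *)
definition subdifferential ::
    "('a::real_normed_vector \<Rightarrow> ereal) \<Rightarrow> 'a \<Rightarrow> ('a \<Rightarrow>\<^sub>L real) set" where
  "subdifferential J u =
     {p. \<forall>v. J v - J u - ereal (blinfun_apply p (v - u)) \<ge> 0}"

(* The adjoint with the dual of the domain kept as is, while the Hilbert space is
   identified with its dual: it maps h to the functional u \<mapsto> h \<bullet> K u.
   (The library's adjoint needs inner products on both sides.) *)
definition dual_adjoint ::
    "('a::real_normed_vector \<Rightarrow>\<^sub>L 'h::real_inner) \<Rightarrow> 'h \<Rightarrow> ('a \<Rightarrow>\<^sub>L real)" where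
  "dual_adjoint K h = blinfun_inner_right h o\<^sub>L K"

lemma dual_adjoint_apply:
  "blinfun_apply (dual_adjoint K h) u = h \<bullet> blinfun_apply K u"
  by (simp add: dual_adjoint_def)

definition singular_vector ::
    "('a::real_normed_vector \<Rightarrow>\<^sub>L 'h::real_inner) \<Rightarrow> ('a \<Rightarrow> ereal) \<Rightarrow> real \<Rightarrow> 'a \<Rightarrow> bool" where
  "singular_vector K J \<sigma> u \<longleftrightarrow>
     u \<noteq> 0 \<and> norm (blinfun_apply K u) = 1 \<and>
     \<sigma> *\<^sub>R dual_adjoint K (blinfun_apply K u) \<in> subdifferential J u"

definition variational_energy ::
    "('a::real_normed_vector \<Rightarrow>\<^sub>L 'h::real_inner) \<Rightarrow> 'h \<Rightarrow> real \<Rightarrow> ('a \<Rightarrow> ereal) \<Rightarrow> 'a \<Rightarrow> ereal" where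
  "variational_energy K f \<alpha> J u =
     ereal (1/2 * (norm (blinfun_apply K u - f))\<^sup>2) + ereal \<alpha> * J u"

end

theory Submission
  imports Defs
begin

text \<open>
  For a one-homogeneous \<open>J\<close>, a subgradient \<open>p\<close> at \<open>u\<close> satisfies \<open>J u = p u\<close> and \<open>p \<le> J\<close> everywhere.
  With \<open>p = \<sigma> K\<^sup>*K u\<^sub>\<sigma>\<close> and \<open>a = K u\<^sub>\<sigma>\<close> this bounds the energy at \<open>v\<close> from below by
  \<open>1/2 \<parallel>K v - \<gamma> a\<parallel>\<^sup>2 + \<alpha> \<sigma> \<langle>a, K v\<rangle>\<close>, with equality at multiples \<open>c u\<^sub>\<sigma>\<close> with \<open>c \<ge> 0\<close>. Completing the
  square shows that this lower bound is smallest where \<open>K v = (\<gamma> - \<alpha> \<sigma>) a\<close>.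
\<close>

lemma one_homogeneous_zero:
  assumes "one_homogeneous J"
  shows "J 0 = 0"
proof -
  have "J (0 *\<^sub>R 0) = ereal \<bar>0\<bar> * J 0"
    using assms unfolding one_homogeneous_def by blast
  then show ?thesis by (simp flip: zero_ereal_def)
qed

lemma one_homogeneous_scaleR:
  assumes "one_homogeneous J"
  shows "J (c *\<^sub>R u) = ereal \<bar>c\<bar> * J u"
  using assms unfolding one_homogeneous_def by blast

text \<open>Along the ray through \<open>u\<close> the functional is linear, so testing the
  subgradient inequality at \<open>0\<close> and at \<open>2 *\<^sub>R u\<close> gives the two
  opposite inequalities.\<close>

lemma one_homogeneous_subgradient_eq:
  assumes "proper_functional J" "one_homogeneous J" "p \<in> subdifferential J u"
  shows "J u = ereal (blinfun_apply p u)"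
proof -
  have sub: "0 \<le> J v - J u - ereal (blinfun_apply p (v - u))" for v
    using assms(3) by (simp add: subdifferential_def)
  have J0: "J 0 = 0" by (rule one_homogeneous_zero[OF assms(2)])
  \<comment> \<open>An infinite \<open>J u\<close> would turn the inequality at \<open>0\<close>
    into \<open>0 \<le> -\<infinity>\<close>.\<close>
  have "J u \<noteq> \<infinity>" using sub[of 0] J0 by auto
  moreover have "J u \<noteq> -\<infinity>" using assms(1) by (simp add: proper_functional_def)
  ultimately obtain j where j: "J u = ereal j" by (cases "J u") auto
  have J2: "J (2 *\<^sub>R u) = ereal (2 * j)"
    using one_homogeneous_scaleR[OF assms(2), of 2 u] by (simp add: j)
  have "j \<le> blinfun_apply p u"
    using sub[of 0] by (simp add: J0 j blinfun.minus_right zero_ereal_def)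
  moreover have "blinfun_apply p u \<le> j"
    using sub[of "2 *\<^sub>R u"] by (simp add: J2 j blinfun.diff_right blinfun.scaleR_right zero_ereal_def)
  ultimately show ?thesis by (simp add: j)
qed

text \<open>Since \<open>J u\<close> equals the finite value \<open>p u\<close>, the terms in
  \<open>u\<close> cancel from the subgradient inequality.\<close>

lemma one_homogeneous_subgradient_le:
  assumes "proper_functional J" "one_homogeneous J" "p \<in> subdifferential J u"
  shows "ereal (blinfun_apply p v) \<le> J v"
proof -
  have "0 \<le> J v - J u - ereal (blinfun_apply p (v - u))"
    using assms(3) by (simp add: subdifferential_def)
  then show ?thesis
    using one_homogeneous_subgradient_eq[OF assms]
    by (cases "J v") (auto simp: blinfun.diff_right zero_ereal_def)
qed

text \<open>The linear term moves the centre of the square from \<open>\<gamma> *\<^sub>R a\<close>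
  to \<open>c *\<^sub>R a\<close>; as \<open>a \<bullet> a = 1\<close>, only a constant
  remains.\<close>

lemma complete_square_unit:
  fixes a x :: "'h::real_inner"
  assumes "norm a = 1"
  shows "1/2 * (norm (x - \<gamma> *\<^sub>R a))\<^sup>2 + (\<gamma> - c) * (a \<bullet> x)
       = 1/2 * (norm (x - c *\<^sub>R a))\<^sup>2 + (\<gamma>\<^sup>2 - c\<^sup>2) / 2"
proof -
  have "a \<bullet> a = 1" using assms by (simp add: dot_square_norm)
  then show ?thesis
    unfolding power2_norm_eq_inner
    by (simp add: inner_diff inner_commute[of x a] power2_eq_square field_simps)
qed

theorem theorem5:
  fixes K :: "('x::banach \<Rightarrow>\<^sub>L real) \<Rightarrow>\<^sub>L 'h::{real_inner, complete_space}"
    and J :: "('x \<Rightarrow>\<^sub>L real) \<Rightarrow> ereal"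
    and u\<^sub>\<sigma> :: "'x \<Rightarrow>\<^sub>L real"
    and f :: 'h
    and \<sigma> \<alpha> \<gamma> c :: real
  assumes "proper_functional J"
    and "convex_functional J"
    and "\<And>u. 0 \<le> J u"
    and "\<And>u. u \<in> eff_dom J \<Longrightarrow> subdifferential J u \<noteq> {}"
    and "one_homogeneous J"
    and "singular_vector K J \<sigma> u\<^sub>\<sigma>"
    and "\<alpha> > 0"
    and "\<gamma> > 0"
    and "f = \<gamma> *\<^sub>R blinfun_apply K u\<^sub>\<sigma>"
    and "\<gamma> > \<alpha> * \<sigma>"
    and "c = \<gamma> - \<alpha> * \<sigma>"
  shows "is_arg_min (variational_energy K f \<alpha> J) (\<lambda>u. u \<in> eff_dom J) (c *\<^sub>R u\<^sub>\<sigma>)"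
proof -
  let ?a = "blinfun_apply K u\<^sub>\<sigma>"
  let ?p = "\<sigma> *\<^sub>R dual_adjoint K ?a"
  have na: "norm ?a = 1" and p: "?p \<in> subdifferential J u\<^sub>\<sigma>"
    using assms(6) by (auto simp: singular_vector_def)
  have p_apply: "blinfun_apply ?p v = \<sigma> * (?a \<bullet> blinfun_apply K v)" for v
    by (simp add: blinfun.scaleR_left dual_adjoint_apply)
  have "J u\<^sub>\<sigma> = ereal \<sigma>"
    using one_homogeneous_subgradient_eq[OF assms(1,5) p] na
    by (simp add: p_apply dot_square_norm)
  \<comment> \<open>The condition \<open>\<gamma> > \<alpha> * \<sigma>\<close> makes
    \<open>c\<close> positive, so \<open>\<bar>c\<bar> = c\<close>.\<close>
  then have Jc: "J (c *\<^sub>R u\<^sub>\<sigma>) = ereal (c * \<sigma>)"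
    using one_homogeneous_scaleR[OF assms(5), of c u\<^sub>\<sigma>] assms(10,11) by simp
  have c: "\<alpha> * \<sigma> = \<gamma> - c" using assms(11) by simp
  have min: "variational_energy K f \<alpha> J (c *\<^sub>R u\<^sub>\<sigma>) = ereal ((\<gamma>\<^sup>2 - c\<^sup>2) / 2)"
  proof -
    \<comment> \<open>At \<open>c *\<^sub>R ?a\<close> the completed square vanishes.\<close>
    have "1/2 * (norm (c *\<^sub>R ?a - f))\<^sup>2 + \<alpha> * (c * \<sigma>) = (\<gamma>\<^sup>2 - c\<^sup>2) / 2"
      using complete_square_unit[OF na, of "c *\<^sub>R ?a" \<gamma> c] na
      by (simp add: assms(9) dot_square_norm flip: c) (simp add: ac_simps)
    then show ?thesis
      by (simp add: variational_energy_def Jc blinfun.scaleR_right)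
  qed
  have le: "ereal ((\<gamma>\<^sup>2 - c\<^sup>2) / 2) \<le> variational_energy K f \<alpha> J v" for v
  proof -
    let ?x = "blinfun_apply K v"
    \<comment> \<open>The difference of the two sides is the completed square, which is
      nonnegative.\<close>
    have "(\<gamma>\<^sup>2 - c\<^sup>2) / 2 \<le> 1/2 * (norm (?x - f))\<^sup>2 + \<alpha> * (\<sigma> * (?a \<bullet> ?x))"
      using complete_square_unit[OF na, of ?x \<gamma> c]
      by (simp add: assms(9) mult.assoc flip: c)
    then have "ereal ((\<gamma>\<^sup>2 - c\<^sup>2) / 2)
        \<le> ereal (1/2 * (norm (?x - f))\<^sup>2) + ereal \<alpha> * ereal (blinfun_apply ?p v)"
      by (simp only: p_apply times_ereal.simps plus_ereal.simps ereal_less_eq)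
    also have "\<dots> \<le> variational_energy K f \<alpha> J v"
      unfolding variational_energy_def
      using one_homogeneous_subgradient_le[OF assms(1,5) p] assms(7)
      by (intro add_left_mono ereal_mult_left_mono) auto
    finally show ?thesis .
  qed
  show ?thesis
    using le by (auto simp: is_arg_min_def min eff_dom_def Jc not_less)
qed

end
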